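(* Let $a\in\{1,2\}$, let $b$ be a positive integer coprime to $a$, and put $m=2b/a$. Let $r_n$ denote the cobalancer of the $n$-th $(a,b)$ cobalancing number (cobalancing numbers listed in increasing order, $n\ge 1$). Then $$r_n=(2m+2)\,r_{n-1}-r_{n-2}\qquad (n\ge 3),$$ with initial terms $r_1=1$ and $r_2=2m+2$.
   Context: For coprime positive integers $a,b$, an $(a,b)$ cobalancing number is a positive integer $n$ such that $$a\left(1+2+\cdots+n\right)=b\left((n+1)+(n+2)+\cdots+(n+r)\right)$$ for some positive integer $r$; this $r$ is called the cobalancer of $n$. *)

theory Defs
  imports Complex_Main "HOL-Library.Infinite_Set"
begin

definition is_cobalancer :: "nat \<Rightarrow> nat \<Rightarrow> nat \<Rightarrow> nat \<Rightarrow> bool" where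
  "is_cobalancer a b n r \<longleftrightarrow> r > 0 \<and> a * (\<Sum>i=1..n. i) = b * (\<Sum>i=n+1..n+r. i)"

definition cobalancing_numbers :: "nat \<Rightarrow> nat \<Rightarrow> nat set" where
  "cobalancing_numbers a b = {n. n > 0 \<and> (\<exists>r. is_cobalancer a b n r)}"

definition cobalancer :: "nat \<Rightarrow> nat \<Rightarrow> nat \<Rightarrow> nat" where
  "cobalancer a b n = (THE r. is_cobalancer a b n r)"

text \<open>The list of cobalancing numbers starts at index 1, whereas \<^const>\<open>enumerate\<close>
  counts from 0.  Only arguments \<open>k \<ge> 1\<close> are meaningful below.\<close>

definition nth_cobalancing_number :: "nat \<Rightarrow> nat \<Rightarrow> nat \<Rightarrow> nat" where
  "nth_cobalancing_number a b k = enumerate (cobalancing_numbers a b) (k - 1)"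

definition nth_cobalancer :: "nat \<Rightarrow> nat \<Rightarrow> nat \<Rightarrow> nat" where
  "nth_cobalancer a b k = cobalancer a b (nth_cobalancing_number a b k)"

text \<open>The remaining lemmas show that the description operator in \<^const>\<open>cobalancer\<close> and the
  enumeration in \<^const>\<open>nth_cobalancing_number\<close> are applied only where they are well-defined.\<close>

lemma double_sum_from: "2 * (\<Sum>i=n+1..n+r. i) = r * (2 * n + r + 1)" for n r :: nat
  by (induction r) (auto simp: algebra_simps)

lemma is_cobalancer_iff:
  "is_cobalancer a b n r \<longleftrightarrow> r > 0 \<and> a * (n * (n + 1)) = b * (r * (2 * n + r + 1))"
proof -
  have "a * (\<Sum>i=1..n. i) = b * (\<Sum>i=n+1..n+r. i) \<longleftrightarrow>
        a * (2 * (\<Sum>i=1..n. i)) = b * (2 * (\<Sum>i=n+1..n+r. i))"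
    by (metis mult.left_commute mult_cancel1 zero_neq_numeral)
  also have "2 * (\<Sum>i=1..n. i) = n * (n + 1)"
    using double_sum_from[of 0 n] by simp
  finally show ?thesis
    unfolding is_cobalancer_def double_sum_from by blast
qed

lemma is_cobalancer_unique:
  assumes "b > 0" "is_cobalancer a b n r" "is_cobalancer a b n s"
  shows "r = s"
proof -
  have less: "x * (2 * n + x + 1) < y * (2 * n + y + 1)" if "x < y" for x y :: nat
    using that by (intro mult_strict_mono) auto
  have "r * (2 * n + r + 1) = s * (2 * n + s + 1)"
    using assms by (auto simp: is_cobalancer_iff)
  then show ?thesis
    using less[of r s] less[of s r] by (cases r s rule: linorder_cases) auto
qed

lemma cobalancer_is_cobalancer:
  assumes "b > 0" "n \<in> cobalancing_numbers a b"
  shows "is_cobalancer a b n (cobalancer a b n)"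
proof -
  obtain r where "is_cobalancer a b n r"
    using assms(2) by (auto simp: cobalancing_numbers_def)
  then show ?thesis
    unfolding cobalancer_def by (rule theI) (metis assms(1) is_cobalancer_unique \<open>is_cobalancer a b n r\<close>)
qed

lemma infinite_cobalancing_numbers:
  assumes "a = 1 \<or> a = 2" "b > 0"
  shows "infinite (cobalancing_numbers a b)"
proof -
  define m where "m = 2 * b div a"
  have m: "m > 0" "a * m = 2 * b" using assms by (auto simp: m_def)
  have iff: "is_cobalancer a b n r \<longleftrightarrow> r > 0 \<and> 2 * (n * (n + 1)) = m * (r * (2 * n + r + 1))" for n r
  proof -
    have "a * (n * (n + 1)) = b * (r * (2 * n + r + 1)) \<longleftrightarrow>
          2 * (n * (n + 1)) = m * (r * (2 * n + r + 1))"
      using assms m by auto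
    then show ?thesis by (simp only: is_cobalancer_iff)
  qed
  have step: "is_cobalancer a b (m * r + (2 * m + 1) * n + m) (r + 2 * n + 1)"
    if "is_cobalancer a b n r" for n r
  proof -
    let ?n = "m * r + (2 * m + 1) * n + m" and ?r = "r + 2 * n + 1"
    have "2 * (n * (n + 1)) = m * (r * (2 * n + r + 1))"
      using that unfolding iff by blast
    moreover have "2 * (?n * (?n + 1)) + m * (r * (2 * n + r + 1)) =
                   m * (?r * (2 * ?n + ?r + 1)) + 2 * (n * (n + 1))"
      by (simp add: algebra_simps)
    ultimately have "2 * (?n * (?n + 1)) = m * (?r * (2 * ?n + ?r + 1))" by linarith
    then show ?thesis unfolding iff by simp
  qed
  have "\<exists>n\<ge>k. n > 0 \<and> (\<exists>r. is_cobalancer a b n r)" for k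
  proof (induction k)
    case 0
    have "is_cobalancer a b m 1" unfolding iff by (simp add: algebra_simps)
    then show ?case using m by auto
  next
    case (Suc k)
    then obtain n r where nr: "n \<ge> k" "n > 0" "is_cobalancer a b n r" by auto
    have "Suc k \<le> m * r + (2 * m + 1) * n + m" using nr m by (simp add: add_mult_distrib)
    moreover have "0 < m * r + (2 * m + 1) * n + m" using m by simp
    ultimately show ?case using step[OF nr(3)] by blast
  qed
  then show ?thesis unfolding infinite_nat_iff_unbounded_le cobalancing_numbers_def by auto
qed

end

(* Completing the square turns the cobalancing equation into the Pell equation
   (2n + 1 - m r)^2 - (m^2 + 2m) r^2 = 1, with fundamental solution (m + 1, 1).
   In terms of (n, r), multiplication by the fundamental unit is the map
   (n, r) |-> (m r + (2m + 1) n + m, r + 2n + 1), and descent along it shows that every solution is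
   obtained by iterating it from the trivial one (0, 0). *)
theory Submission
  imports Defs
begin

text \<open>An increasing \<open>f\<close> skips nothing in its range: the least value above
  \<open>f k\<close> is \<open>f (Suc k)\<close>.\<close>

lemma enumerate_range_strict_mono:
  fixes f :: "nat \<Rightarrow> nat"
  assumes "strict_mono f"
  shows "enumerate (range f) = f"
proof
  have inf: "infinite (range f)"
    using assms by (simp add: range_inj_infinite strict_mono_imp_inj_on)
  show "enumerate (range f) k = f k" for k
  proof (induction k)
    case 0
    show ?case
      unfolding enumerate_0 using assms
      by (intro Least_equality) (auto simp: strict_mono_less_eq)
  next
    case (Suc k)
    have "enumerate (range f) (Suc k) = (LEAST s. s \<in> range f \<and> f k < s)"
      using enumerate_Suc''[OF inf, of k] Suc.IH by simp
    also have "\<dots> = f (Suc k)"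
      using assms by (intro Least_equality) (auto simp: strict_mono_less strict_mono_less_eq)
    finally show ?case .
  qed
qed

text \<open>The cobalancing equation in terms of the ratio \<open>m\<close> alone. Positivity of
  \<open>r\<close> is left out so that (0, 0) is a solution and descent can end there.\<close>

definition cobal_eq :: "nat \<Rightarrow> nat \<Rightarrow> nat \<Rightarrow> bool" where
  "cobal_eq m n r \<longleftrightarrow> 2 * (n * (n + 1)) = m * (r * (2 * n + r + 1))"

lemma is_cobalancer_iff_cobal_eq:
  assumes "a * m = 2 * b" "a > 0"
  shows "is_cobalancer a b n r \<longleftrightarrow> r > 0 \<and> cobal_eq m n r"
proof -
  have "a * x = b * y \<longleftrightarrow> 2 * x = m * y" for x y
  proof -
    have "a * x = b * y \<longleftrightarrow> a * (2 * x) = 2 * b * y"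
      by auto
    also have "\<dots> \<longleftrightarrow> a * (2 * x) = a * (m * y)"
      by (simp only: assms(1)[symmetric] mult.assoc)
    also have "\<dots> \<longleftrightarrow> 2 * x = m * y"
      using assms(2) by simp
    finally show ?thesis .
  qed
  then show ?thesis
    by (simp only: is_cobalancer_iff cobal_eq_def)
qed

lemma cobal_eq_step:
  assumes "cobal_eq m n r"
  shows "cobal_eq m (m * r + (2 * m + 1) * n + m) (r + 2 * n + 1)"
proof -
  let ?n = "m * r + (2 * m + 1) * n + m" and ?r = "r + 2 * n + 1"
  \<comment> \<open>The difference of the two sides of the equation is invariant under the map;
    writing this additively avoids truncated subtraction.\<close>
  have "2 * (?n * (?n + 1)) + m * (r * (2 * n + r + 1)) =
        m * (?r * (2 * ?n + ?r + 1)) + 2 * (n * (n + 1))"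
    by (simp add: algebra_simps)
  with assms show ?thesis
    unfolding cobal_eq_def by linarith
qed

text \<open>Inverting the map gives \<open>n' = n - m * r\<close> and
  \<open>r' = r - 2 * n' - 1\<close>; the two bounds in the proof show that these are natural
  numbers.\<close>

lemma cobal_eq_descent:
  assumes eq: "cobal_eq m n r" and "m > 0" "r > 0"
  obtains n' r' where "cobal_eq m n' r'" "n = m * r' + (2 * m + 1) * n' + m" "r = r' + 2 * n' + 1"
proof -
  have "m * r \<le> n"
  proof (rule ccontr)
    assume "\<not> m * r \<le> n"
    then have "2 * n * (n + 1) \<le> 2 * n * (m * r)"
      by (intro mult_le_mono2) simp
    also have "\<dots> < m * (r * (2 * n + r + 1))"
      using assms by (simp add: algebra_simps)
    finally show False
      using eq by (simp add: cobal_eq_def)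
  qed
  then obtain n' where n': "n = m * r + n'"
    using le_Suc_ex by blast
  \<comment> \<open>The quadratic terms in \<open>m\<close> cancel. The remaining positive summand
    \<open>m * r\<close> makes the bound on \<open>2 * n'\<close> strict.\<close>
  have eq': "2 * (m * r * n') + 2 * (n' * (n' + 1)) + m * r = m * r * r"
    using eq unfolding cobal_eq_def n' by (simp add: algebra_simps)
  have "2 * n' < r"
  proof (rule ccontr)
    assume "\<not> 2 * n' < r"
    then have "m * r * r \<le> m * r * (2 * n')"
      by (intro mult_le_mono2) simp
    moreover have "m * r > 0"
      using assms by simp
    moreover have "m * r * (2 * n') = 2 * (m * r * n')"
      by simp
    ultimately show False
      using eq' by linarith
  qed
  then obtain r' where r': "r = r' + 2 * n' + 1"
    using less_imp_Suc_add[of "2 * n'" r] by (auto simp: add.commute)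
  have "cobal_eq m n' r'"
    using eq' unfolding cobal_eq_def r' by (simp add: algebra_simps)
  moreover have "n = m * r' + (2 * m + 1) * n' + m"
    unfolding n' r' by (simp add: algebra_simps)
  ultimately show thesis
    using r' that by blast
qed

primrec cobal_sol :: "nat \<Rightarrow> nat \<Rightarrow> nat \<times> nat" where
  "cobal_sol m 0 = (0, 0)"
| "cobal_sol m (Suc k) =
     (let (n, r) = cobal_sol m k in (m * r + (2 * m + 1) * n + m, r + 2 * n + 1))"

lemma cobal_sol_Suc:
  "fst (cobal_sol m (Suc k)) = m * snd (cobal_sol m k) + (2 * m + 1) * fst (cobal_sol m k) + m"
  "snd (cobal_sol m (Suc k)) = snd (cobal_sol m k) + 2 * fst (cobal_sol m k) + 1"
  by (simp_all add: case_prod_beta Let_def)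

declare cobal_sol.simps(2) [simp del]

lemma cobal_eq_cobal_sol: "cobal_eq m (fst (cobal_sol m k)) (snd (cobal_sol m k))"
proof (induction k)
  case 0
  show ?case by (simp add: cobal_eq_def)
next
  case (Suc k)
  then show ?case
    unfolding cobal_sol_Suc by (rule cobal_eq_step)
qed

text \<open>Descent strictly lowers \<open>r\<close>, and \<open>r = 0\<close> forces
  \<open>n = 0\<close>, the start of the orbit.\<close>

lemma cobal_eq_imp_cobal_sol:
  assumes "cobal_eq m n r" "m > 0"
  shows "\<exists>k. (n, r) = cobal_sol m k"
  using assms(1)
proof (induction r arbitrary: n rule: less_induct)
  case (less r)
  show ?case
  proof (cases "r = 0")
    case True
    with less.prems have "(n, r) = cobal_sol m 0"
      by (simp add: cobal_eq_def)
    then show ?thesis ..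
  next
    case False
    with less.prems \<open>m > 0\<close> obtain n' r' where *: "cobal_eq m n' r'"
      "n = m * r' + (2 * m + 1) * n' + m" "r = r' + 2 * n' + 1"
      by (blast elim: cobal_eq_descent)
    then obtain k where k: "(n', r') = cobal_sol m k"
      using less.IH by fastforce
    have "(n, r) = cobal_sol m (Suc k)"
      by (simp add: cobal_sol.simps(2) * flip: k)
    then show ?thesis ..
  qed
qed

lemma strict_mono_cobal_sol:
  assumes "m > 0"
  shows "strict_mono (\<lambda>k. fst (cobal_sol m k))"
  unfolding strict_mono_Suc_iff using assms by (simp add: cobal_sol_Suc)

text \<open>With (n, r) the solution at \<open>k\<close> and (N, R) the next one, N = m R + n and 2n
  + 1 = R - r, so the cobalancer after R is R + 2N + 1 = (2m + 2) R - r.\<close>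

lemma snd_cobal_sol_recurrence:
  "snd (cobal_sol m (Suc (Suc k))) + snd (cobal_sol m k) = (2 * m + 2) * snd (cobal_sol m (Suc k))"
  by (simp add: cobal_sol_Suc algebra_simps)

text \<open>The shift to \<open>Suc k\<close> discards the trivial solution (0, 0).\<close>

lemma cobalancing_numbers_eq_range:
  assumes "a * m = 2 * b" "a > 0" "m > 0"
  shows "cobalancing_numbers a b = range (\<lambda>k. fst (cobal_sol m (Suc k)))"
proof (intro set_eqI iffI)
  fix n
  assume "n \<in> cobalancing_numbers a b"
  then obtain r where "n > 0" "cobal_eq m n r"
    using assms by (auto simp: cobalancing_numbers_def is_cobalancer_iff_cobal_eq)
  then obtain k where k: "(n, r) = cobal_sol m k"
    using cobal_eq_imp_cobal_sol assms by blast
  with \<open>n > 0\<close> obtain j where "k = Suc j"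
    by (cases k) auto
  with k have "n = fst (cobal_sol m (Suc j))"
    by (metis fst_conv)
  then show "n \<in> range (\<lambda>k. fst (cobal_sol m (Suc k)))"
    by blast
next
  fix n
  assume "n \<in> range (\<lambda>k. fst (cobal_sol m (Suc k)))"
  then obtain k where k: "n = fst (cobal_sol m (Suc k))"
    by blast
  have "is_cobalancer a b n (snd (cobal_sol m (Suc k)))"
    using cobal_eq_cobal_sol[of m "Suc k"]
    by (simp add: is_cobalancer_iff_cobal_eq[OF assms(1,2)] k cobal_sol_Suc(2)[of m k])
  moreover have "n > 0"
    using assms by (simp add: k cobal_sol_Suc)
  ultimately show "n \<in> cobalancing_numbers a b"
    by (auto simp: cobalancing_numbers_def)
qed

lemma nth_cobalancer_eq_cobal_sol:
  assumes "a * m = 2 * b" "a > 0" "m > 0"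
  shows "nth_cobalancer a b (Suc k) = snd (cobal_sol m (Suc k))"
proof -
  have "strict_mono (\<lambda>k. fst (cobal_sol m (Suc k)))"
    using strict_mono_cobal_sol[OF \<open>m > 0\<close>] by (simp add: strict_mono_Suc_iff)
  \<comment> \<open>The \<open>k - 1\<close> in the 1-based listing and the discarded trivial
    solution offset each other, so the indices agree.\<close>
  then have n: "nth_cobalancing_number a b (Suc k) = fst (cobal_sol m (Suc k))"
    by (simp add: nth_cobalancing_number_def cobalancing_numbers_eq_range[OF assms]
        enumerate_range_strict_mono)
  have "b > 0"
    using assms by (metis mult_is_0 neq0_conv)
  moreover have "is_cobalancer a b (fst (cobal_sol m (Suc k))) (snd (cobal_sol m (Suc k)))"
    using cobal_eq_cobal_sol[of m "Suc k"]
    by (simp add: is_cobalancer_iff_cobal_eq[OF assms(1,2)] cobal_sol_Suc(2)[of m k])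
  ultimately show ?thesis
    unfolding nth_cobalancer_def cobalancer_def n
    by (blast intro: is_cobalancer_unique)
qed

theorem theorem1p5:
  fixes a b :: nat and m :: real and r :: "nat \<Rightarrow> real"
  assumes "a \<in> {1, 2}" and "b > 0" and "coprime a b"
  defines "m \<equiv> 2 * real b / real a"
    and "r \<equiv> \<lambda>k. real (nth_cobalancer a b k)"
  shows "r 1 = 1 \<and> r 2 = 2 * m + 2 \<and>
         (\<forall>n\<ge>3. r n = (2 * m + 2) * r (n - 1) - r (n - 2))"
proof -
  \<comment> \<open>The division is exact because \<open>a\<close> is 1 or 2, so the real
    \<open>m\<close> is a natural number.\<close>
  define M where "M = 2 * b div a"
  consider "a = 1" | "a = 2"
    using assms(1) by blast
  then have M: "a * M = 2 * b" "a > 0" "M > 0" and m: "m = real M"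
    using assms(2) unfolding M_def m_def by (cases; simp)+
  have r: "r (Suc k) = real (snd (cobal_sol M (Suc k)))" for k
    by (simp add: r_def nth_cobalancer_eq_cobal_sol[OF M])
  have "r 1 = 1"
    using r[of 0] by (simp add: cobal_sol_Suc)
  moreover have "r 2 = 2 * m + 2"
    using r[of 1] by (simp add: cobal_sol_Suc m numeral_2_eq_2)
  moreover have "r n = (2 * m + 2) * r (n - 1) - r (n - 2)" if "n \<ge> 3" for n
  proof -
    obtain k where n: "n = Suc (Suc (Suc k))"
      using le_Suc_ex[OF \<open>n \<ge> 3\<close>] by (auto simp: numeral_3_eq_3)
    have "real (snd (cobal_sol M (Suc (Suc (Suc k)))) + snd (cobal_sol M (Suc k))) =
          real ((2 * M + 2) * snd (cobal_sol M (Suc (Suc k))))"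
      by (simp only: snd_cobal_sol_recurrence)
    then show ?thesis
      by (simp add: n r m algebra_simps)
  qed
  ultimately show ?thesis
    by blast
qed

end
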